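(* Let $H : \mathcal{L}_{2e}^n \to \mathcal{L}_{2e}^n$ be a causal, $\mathcal{L}_2$-stable system, and let $\Pi = \begin{bmatrix} a & b \\ b & c\end{bmatrix}$ with $a,b,c\in\mathbb{R}$ be a positive-negative multiplier. Then $$\mathrm{SG}(H) \subset \mathcal{S}(\Pi) \iff \mathrm{SG}_e(H) \subset \mathcal{S}(\Pi).$$
   Context: $\mathcal{L}_2^n$ is the space of square-integrable signals $u:\mathbb{R}_{\ge 0}\to\mathbb{R}^n$ with inner product $\langle u,y\rangle = \int_0^\infty u(t)^\top y(t)\,dt$ and norm $\|u\|^2=\langle u,u\rangle$. For $T\ge 0$, $\mathcal{P}_T$ denotes truncation to $[0,T]$ (the signal is set to zero after time $T$). $\mathcal{L}_{2e}^n$ is the space of signals $u:\mathbb{R}_{\ge0}\to\mathbb{R}^n$ with $\mathcal{P}_T u\in\mathcal{L}_2^n$ for all $T\ge 0$. $H$ is causal if $\mathcal{P}_T(Hu)=\mathcal{P}_T(H(\mathcal{P}_T u))$ for all $T\ge 0$ and all $u$. $H$ is $\mathcal{L}_2$-stable if it maps $\mathcal{L}_2^n$ into $\mathcal{L}_2^n$ with finite gain: there is $\gamma<\infty$ with $\|Hu\|\le\gamma\|u\|$ for all $u\in\mathcal{L}_2^n$. For $u,y\in\mathcal{L}_2^n$, $u\neq 0$, let $\rho(u,y)=\|y\|/\|u\|$ and $\theta(u,y)=\arccos\!\big(\langle u,y\rangle/(\|u\|\|y\|)\big)$, with $\theta(u,y)=0$ if $y=0$. The soft scaled graph is $$\mathrm{SG}(H)=\{\rho(u,y)e^{\pm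 \mathrm{j}\theta(u,y)} : u\in\mathcal{L}_2^n\setminus\{0\},\ y=Hu\}\subset\mathbb{C}.$$ The hard scaled graph is $$\mathrm{SG}_e(H)=\{\rho(\mathcal{P}_Tu,\mathcal{P}_Ty)e^{\pm \mathrm{j}\theta(\mathcal{P}_Tu,\mathcal{P}_Ty)} : u\in\mathcal{L}_{2e}^n,\ y=Hu,\ T>0,\ \mathcal{P}_T u\ne 0\}.$$ The multiplier region is $\mathcal{S}(\Pi)=\{z\in\mathbb{C} : a|z|^2+2b\,\mathrm{Re}\{z\}+c\ge 0\}$. A real symmetric matrix $\Pi=\begin{bmatrix}\Pi_{11}&\Pi_{12}\\ \Pi_{21}&\Pi_{22}\end{bmatrix}$ with square blocks of equal size is positive-negative if there is $\varepsilon>0$ with $\Pi_{22}\succeq\varepsilon I$ and $\Pi_{11}\preceq-\varepsilon I$; for the $2\times2$ matrix here this means $a<0<c$. *)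

theory Defs
  imports "HOL-Analysis.Analysis"
begin

text \<open>
  A signal on the half-line is represented by a function on the reals of which only the values at
  nonnegative times matter: all notions below refer to Lebesgue measure on \<open>{0..}\<close>. Elements of
  the signal spaces are functions up to equality almost everywhere; this equality is \<open>sig_eq\<close>.
\<close>

type_synonym 'n signal = "real \<Rightarrow> real ^ 'n"

definition sig_eq :: "'n::finite signal \<Rightarrow> 'n signal \<Rightarrow> bool" where
  "sig_eq u v \<longleftrightarrow> (AE t in lebesgue_on {0..}. u t = v t)"

definition L2 :: "'n::finite signal set" where
  "L2 = {u. u \<in> borel_measurable (lebesgue_on {0..}) \<and>
            integrable (lebesgue_on {0..}) (\<lambda>t. (norm (u t))\<^sup>2)}"

definition sig_inner :: "'n::finite signal \<Rightarrow> 'n signal \<Rightarrow> real" where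
  "sig_inner u y = (LINT t|lebesgue_on {0..}. u t \<bullet> y t)"

definition sig_norm :: "'n::finite signal \<Rightarrow> real" where
  "sig_norm u = sqrt (sig_inner u u)"

definition trunc :: "real \<Rightarrow> 'n::finite signal \<Rightarrow> 'n signal" where
  "trunc T u = (\<lambda>t. if t \<le> T then u t else 0)"

definition L2e :: "'n::finite signal set" where
  "L2e = {u. \<forall>T\<ge>0. trunc T u \<in> L2}"

text \<open>
  A map from the extended space to itself: an operation on representatives that is compatible
  with equality almost everywhere.
\<close>

definition L2e_map :: "('n::finite signal \<Rightarrow> 'n signal) \<Rightarrow> bool" where
  "L2e_map H \<longleftrightarrow> H \<in> L2e \<rightarrow> L2e \<and>
     (\<forall>u\<in>L2e. \<forall>v\<in>L2e. sig_eq u v \<longrightarrow> sig_eq (H u) (H v))"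

definition causal :: "('n::finite signal \<Rightarrow> 'n signal) \<Rightarrow> bool" where
  "causal H \<longleftrightarrow> (\<forall>T\<ge>0. \<forall>u\<in>L2e. sig_eq (trunc T (H u)) (trunc T (H (trunc T u))))"

definition L2_stable :: "('n::finite signal \<Rightarrow> 'n signal) \<Rightarrow> bool" where
  "L2_stable H \<longleftrightarrow> H \<in> L2 \<rightarrow> L2 \<and> (\<exists>\<gamma>. \<forall>u\<in>L2. sig_norm (H u) \<le> \<gamma> * sig_norm u)"

definition gain :: "'n::finite signal \<Rightarrow> 'n signal \<Rightarrow> real" where
  "gain u y = sig_norm y / sig_norm u"

definition phase :: "'n::finite signal \<Rightarrow> 'n signal \<Rightarrow> real" where
  "phase u y = (if sig_eq y (\<lambda>_. 0) then 0
                else arccos (sig_inner u y / (sig_norm u * sig_norm y)))"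

definition sg_points :: "'n::finite signal \<Rightarrow> 'n signal \<Rightarrow> complex set" where
  "sg_points u y = {of_real (gain u y) * exp (\<i> * of_real (phase u y)),
                    of_real (gain u y) * exp (- \<i> * of_real (phase u y))}"

definition soft_SG :: "('n::finite signal \<Rightarrow> 'n signal) \<Rightarrow> complex set" where
  "soft_SG H = (\<Union>u \<in> {u \<in> L2. \<not> sig_eq u (\<lambda>_. 0)}. sg_points u (H u))"

definition hard_SG :: "('n::finite signal \<Rightarrow> 'n signal) \<Rightarrow> complex set" where
  "hard_SG H = (\<Union>(u, T) \<in> {(u, T). u \<in> L2e \<and> T > 0 \<and> \<not> sig_eq (trunc T u) (\<lambda>_. 0)}.
                  sg_points (trunc T u) (trunc T (H u)))"

definition multiplier :: "real \<Rightarrow> real \<Rightarrow> real \<Rightarrow> real ^ 2 ^ 2" where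
  "multiplier a b c = vector [vector [a, b], vector [b, c]]"

text \<open>The blocks of a 2-by-2 multiplier are scalars, so the Loewner order is the order on reals.\<close>

definition positive_negative :: "real ^ 2 ^ 2 \<Rightarrow> bool" where
  "positive_negative M \<longleftrightarrow> transpose M = M \<and>
     (\<exists>\<epsilon>>0. M $ 2 $ 2 \<ge> \<epsilon> \<and> M $ 1 $ 1 \<le> - \<epsilon>)"

lemma positive_negative_multiplier_iff:
  "positive_negative (multiplier a b c) \<longleftrightarrow> a < 0 \<and> 0 < c"
proof
  assume "a < 0 \<and> 0 < c"
  then show "positive_negative (multiplier a b c)"
    unfolding positive_negative_def multiplier_def
    by (auto simp: vec_eq_iff transpose_def forall_2 intro!: exI[of _ "min (- a) c"])
qed (auto simp: positive_negative_def multiplier_def)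

definition multiplier_region :: "real ^ 2 ^ 2 \<Rightarrow> complex set" where
  "multiplier_region M =
     {z. M $ 1 $ 1 * (cmod z)\<^sup>2 + 2 * M $ 1 $ 2 * Re z + M $ 2 $ 2 \<ge> 0}"

end

(* A scaled-graph point of (u, y) lies in the region iff the quadratic form
   q(u, y) = a|y|^2 + 2b<u, y> + c|u|^2 is nonnegative. Truncations of a square-integrable pair
   converge, so the hard inclusion gives the soft one in the limit T -> infinity. Conversely, by
   causality a truncated pair is (v, P_T w) with v = P_T u and w = H v; here <v, P_T w> = <v, w>
   and |P_T w| <= |w|, so a < 0 gives q(v, P_T w) >= q(v, w) >= 0. *)

theory Submission
  imports Defs
begin

text \<open>The integrand is dominated by the sum of the two energies, since Cauchy-Schwarz and
  \<open>2 * p * q \<le> p^2 + q^2\<close> bound it pointwise.\<close>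

lemma L2_inner_integrable:
  fixes u y :: "'n::finite signal"
  assumes "u \<in> L2" "y \<in> L2"
  shows "integrable (lebesgue_on {0..}) (\<lambda>t. u t \<bullet> y t)"
proof (rule Bochner_Integration.integrable_bound)
  show "integrable (lebesgue_on {0..}) (\<lambda>t. (norm (u t))\<^sup>2 + (norm (y t))\<^sup>2)"
    using assms by (auto simp: L2_def)
  show "(\<lambda>t. u t \<bullet> y t) \<in> borel_measurable (lebesgue_on {0..})"
    using assms by (auto simp: L2_def)
  have "\<bar>p \<bullet> q\<bar> \<le> \<bar>(norm p)\<^sup>2 + (norm q)\<^sup>2\<bar>" for p q :: "real ^ 'n"
  proof -
    have "\<bar>p \<bullet> q\<bar> \<le> norm p * norm q" by (rule Cauchy_Schwarz_ineq2)
    moreover have "2 * norm p * norm q \<le> (norm p)\<^sup>2 + (norm q)\<^sup>2" by (rule sum_squares_bound)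
    moreover have "0 \<le> norm p * norm q" by simp
    ultimately show ?thesis by linarith
  qed
  then show "AE t in lebesgue_on {0..}. norm (u t \<bullet> y t) \<le> norm ((norm (u t))\<^sup>2 + (norm (y t))\<^sup>2)"
    by simp
qed

lemma sig_inner_self_nonneg: "0 \<le> sig_inner u u"
  unfolding sig_inner_def by (rule Bochner_Integration.integral_nonneg) simp

lemma sig_norm_power2: "(sig_norm u)\<^sup>2 = sig_inner u u"
  by (simp add: sig_norm_def sig_inner_self_nonneg)

lemma sig_norm_nonneg: "0 \<le> sig_norm u"
  by (simp add: sig_norm_def sig_inner_self_nonneg)

lemma sig_inner_self_eq_0_iff:
  assumes "u \<in> L2"
  shows "sig_inner u u = 0 \<longleftrightarrow> sig_eq u (\<lambda>_. 0)"
  unfolding sig_inner_def sig_eq_def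
  using integral_nonneg_eq_0_iff_AE[OF L2_inner_integrable[OF assms assms]] by simp

lemma sig_norm_eq_0_iff:
  assumes "u \<in> L2"
  shows "sig_norm u = 0 \<longleftrightarrow> sig_eq u (\<lambda>_. 0)"
  using sig_inner_self_eq_0_iff[OF assms] by (simp add: sig_norm_def)

text \<open>Causality only gives equality almost everywhere; this carries it over to the inner
  products that make up the quadratic form.\<close>

lemma sig_inner_cong:
  assumes "u \<in> L2" "y \<in> L2" "u' \<in> L2" "y' \<in> L2" "sig_eq u u'" "sig_eq y y'"
  shows "sig_inner u y = sig_inner u' y'"
  unfolding sig_inner_def
proof (rule integral_cong_AE)
  show "AE t in lebesgue_on {0..}. u t \<bullet> y t = u' t \<bullet> y' t"
    using assms(5,6) unfolding sig_eq_def by eventually_elim simp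
qed (use assms in \<open>auto simp: L2_def\<close>)

text \<open>Cauchy-Schwarz for signals. It keeps the argument of \<open>arccos\<close> in
  \<open>phase\<close> within [-1, 1].\<close>

lemma sig_inner_le:
  assumes u: "u \<in> L2" and y: "y \<in> L2"
  shows "\<bar>sig_inner u y\<bar> \<le> sig_norm u * sig_norm y"
proof (cases "sig_norm u = 0 \<or> sig_norm y = 0")
  case True
  \<comment> \<open>A signal of norm zero vanishes almost everywhere, hence so does the integrand of
    \<open>sig_inner u y\<close>.\<close>
  have "sig_eq u (\<lambda>_. 0) \<or> sig_eq y (\<lambda>_. 0)"
    using True sig_norm_eq_0_iff u y by blast
  then have "AE t in lebesgue_on {0..}. u t \<bullet> y t = 0"
    unfolding sig_eq_def by (auto elim: eventually_mono)
  then have "sig_inner u y = 0"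
    unfolding sig_inner_def by (rule integral_eq_zero_AE)
  then show ?thesis by (simp add: sig_norm_nonneg)
next
  case False
  define r s where "r = sig_norm u" and "s = sig_norm y"
  have pos: "0 < r" "0 < s"
    using False sig_norm_nonneg[of u] sig_norm_nonneg[of y] by (auto simp: r_def s_def)
  \<comment> \<open>With weight \<open>s\<close> on \<open>u\<close> and \<open>k\<close> equal to
    \<open>r\<close> or \<open>- r\<close> on \<open>y\<close>, the two square terms coincide and
    the energy factors as \<open>2 * s * r * (r * s + sig_inner u y)\<close>, respectively with a
    minus sign.\<close>
  have expand: "(LINT t|lebesgue_on {0..}. (norm (s *\<^sub>R u t + k *\<^sub>R y t))\<^sup>2)
      = s\<^sup>2 * r\<^sup>2 + 2 * s * k * sig_inner u y + k\<^sup>2 * s\<^sup>2" for k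
  proof -
    have "(norm (s *\<^sub>R p + k *\<^sub>R q))\<^sup>2 = s\<^sup>2 * (p \<bullet> p) + 2 * s * k * (p \<bullet> q) + k\<^sup>2 * (q \<bullet> q)"
      for p q :: "real ^ 'a"
      unfolding power2_norm_eq_inner
      by (simp add: inner_add_left inner_add_right inner_commute power2_eq_square algebra_simps)
    then show ?thesis
      using L2_inner_integrable[OF u u] L2_inner_integrable[OF u y] L2_inner_integrable[OF y y]
      by (simp add: r_def s_def sig_norm_power2) (simp add: sig_inner_def)
  qed
  have nn: "0 \<le> (LINT t|lebesgue_on {0..}. (norm (s *\<^sub>R u t + k *\<^sub>R y t))\<^sup>2)" for k
    by (rule Bochner_Integration.integral_nonneg) simp
  have "0 \<le> (2 * s * r) * (r * s + sig_inner u y)" "0 \<le> (2 * s * r) * (r * s - sig_inner u y)"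
    using nn[of r] nn[of "- r"] unfolding expand by (simp_all add: power2_eq_square algebra_simps)
  moreover have "0 < 2 * s * r" using pos by simp
  ultimately have "0 \<le> r * s + sig_inner u y" "0 \<le> r * s - sig_inner u y"
    unfolding zero_le_mult_iff[of "2 * s * r"] by linarith+
  then show ?thesis by (simp add: r_def s_def)
qed

text \<open>The two points are complex conjugates, so they share modulus and real part, which are
  all the region sees. Multiplying its inequality by the positive number
  \<open>(sig_norm u)\<^sup>2\<close> clears the denominators.\<close>

lemma sg_points_region_iff:
  assumes u: "u \<in> L2" "\<not> sig_eq u (\<lambda>_. 0)" and y: "y \<in> L2"
  shows "sg_points u y \<subseteq> multiplier_region (multiplier a b c) \<longleftrightarrow>
         0 \<le> a * sig_inner y y + 2 * b * sig_inner u y + c * sig_inner u u"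
proof -
  define g \<theta> where "g = gain u y" and "\<theta> = phase u y"
  have pos: "0 < sig_norm u"
    using sig_norm_eq_0_iff[OF u(1)] u(2) sig_norm_nonneg[of u] by linarith
  have "g * cos \<theta> = sig_inner u y / (sig_norm u)\<^sup>2"
  proof (cases "sig_eq y (\<lambda>_. 0)")
    \<comment> \<open>The conventional phase 0 is harmless: the gain is 0, and Cauchy-Schwarz makes
      the inner product 0 too.\<close>
    case True
    then have "sig_norm y = 0" using sig_norm_eq_0_iff[OF y] by simp
    with sig_inner_le[OF u(1) y] show ?thesis by (simp add: g_def gain_def)
  next
    case False
    then have ypos: "0 < sig_norm y"
      using sig_norm_eq_0_iff[OF y] sig_norm_nonneg[of y] by linarith
    \<comment> \<open>On [-1, 1] the cosine undoes \<open>arccos\<close>.\<close>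
    have "\<bar>sig_inner u y / (sig_norm u * sig_norm y)\<bar> \<le> 1"
      using sig_inner_le[OF u(1) y] pos ypos by simp
    then have "cos \<theta> = sig_inner u y / (sig_norm u * sig_norm y)"
      using False by (simp add: \<theta>_def phase_def cos_arccos_abs)
    then show ?thesis using pos ypos by (simp add: g_def gain_def power2_eq_square)
  qed
  moreover have "g\<^sup>2 = sig_inner y y / (sig_norm u)\<^sup>2"
    by (simp add: g_def gain_def power_divide sig_norm_power2)
  ultimately have scale: "(sig_norm u)\<^sup>2 * (a * g\<^sup>2 + 2 * b * (g * cos \<theta>) + c)
      = a * sig_inner y y + 2 * b * sig_inner u y + c * sig_inner u u"
    using pos by (simp add: distrib_left mult.left_commute flip: sig_norm_power2[of u])
  have mod: "cmod (of_real g * exp (\<i> * of_real \<theta>)) = \<bar>g\<bar>"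
    "cmod (of_real g * exp (- \<i> * of_real \<theta>)) = \<bar>g\<bar>"
    by (simp_all add: norm_mult)
  have re: "Re (of_real g * exp (\<i> * of_real \<theta>)) = g * cos \<theta>"
    "Re (of_real g * exp (- \<i> * of_real \<theta>)) = g * cos \<theta>"
    by (simp_all add: Re_exp)
  have entries: "multiplier a b c $ 1 $ 1 = a" "multiplier a b c $ 1 $ 2 = b"
    "multiplier a b c $ 2 $ 2 = c"
    by (simp_all add: multiplier_def)
  have "sg_points u y \<subseteq> multiplier_region (multiplier a b c) \<longleftrightarrow>
      0 \<le> a * g\<^sup>2 + 2 * b * (g * cos \<theta>) + c"
    unfolding sg_points_def multiplier_region_def g_def[symmetric] \<theta>_def[symmetric]
    by (simp only: insert_subset empty_subsetI mem_Collect_eq mod re entries power2_abs) simp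
  also have "\<dots> \<longleftrightarrow> 0 \<le> (sig_norm u)\<^sup>2 * (a * g\<^sup>2 + 2 * b * (g * cos \<theta>) + c)"
    using pos by (simp add: zero_le_mult_iff)
  finally show ?thesis unfolding scale .
qed

lemma trunc_measurable:
  assumes "u \<in> borel_measurable (lebesgue_on {0..})"
  shows "trunc T u \<in> borel_measurable (lebesgue_on {0..})"
proof -
  have "{..T} \<inter> {0..} \<in> sets (lebesgue_on {0..})"
    by (simp add: sets_restrict_space_iff)
  then have "Measurable.pred (lebesgue_on {0..}) (\<lambda>t. t \<le> T)"
    by (simp add: pred_def Int_def conj_commute)
  then show ?thesis
    unfolding trunc_def using assms by (intro measurable_If) (simp_all add: pred_def)
qed

lemma trunc_L2:
  assumes "u \<in> L2"
  shows "trunc T u \<in> L2"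
proof -
  have m: "trunc T u \<in> borel_measurable (lebesgue_on {0..})"
    using assms by (intro trunc_measurable) (simp add: L2_def)
  moreover have "integrable (lebesgue_on {0..}) (\<lambda>t. (norm (trunc T u t))\<^sup>2)"
  proof (rule Bochner_Integration.integrable_bound)
    show "integrable (lebesgue_on {0..}) (\<lambda>t. (norm (u t))\<^sup>2)"
      using assms by (simp add: L2_def)
    show "AE t in lebesgue_on {0..}. norm ((norm (trunc T u t))\<^sup>2) \<le> norm ((norm (u t))\<^sup>2)"
      by (simp add: trunc_def)
  qed (use m in measurable)
  ultimately show ?thesis by (simp add: L2_def)
qed

lemma L2_subset_L2e: "L2 \<subseteq> L2e"
  using trunc_L2 by (auto simp: L2e_def)

text \<open>Truncation keeps or deletes values of the nonnegative integrand, so the energy cannot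
  grow.\<close>

lemma sig_inner_trunc_le:
  assumes "u \<in> L2"
  shows "sig_inner (trunc T u) (trunc T u) \<le> sig_inner u u"
  unfolding sig_inner_def
  by (rule integral_mono)
    (use L2_inner_integrable[OF assms assms] L2_inner_integrable[OF trunc_L2 trunc_L2, OF assms assms]
     in \<open>auto simp: trunc_def\<close>)

text \<open>Truncation multiplies by an indicator, a self-adjoint idempotent; the integrands already
  agree pointwise.\<close>

lemma sig_inner_trunc_right: "sig_inner (trunc T u) (trunc T y) = sig_inner (trunc T u) y"
  unfolding sig_inner_def trunc_def
  by (rule Bochner_Integration.integral_cong) auto

text \<open>Dominated convergence with bound \<open>\<bar>u t \<bullet> y t\<bar>\<close>: at each
  fixed time the integrands are constant once \<open>n\<close> has passed \<open>t\<close>.\<close>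

lemma sig_inner_trunc_tendsto:
  assumes u: "u \<in> L2" and y: "y \<in> L2"
  shows "(\<lambda>n. sig_inner (trunc (real n) u) (trunc (real n) y)) \<longlonglongrightarrow> sig_inner u y"
  unfolding sig_inner_def
proof (rule integral_dominated_convergence)
  show "integrable (lebesgue_on {0..}) (\<lambda>t. \<bar>u t \<bullet> y t\<bar>)"
    using L2_inner_integrable[OF u y] by simp
  show "(\<lambda>t. u t \<bullet> y t) \<in> borel_measurable (lebesgue_on {0..})"
    using L2_inner_integrable[OF u y] by (rule borel_measurable_integrable)
  show "(\<lambda>t. trunc (real n) u t \<bullet> trunc (real n) y t) \<in> borel_measurable (lebesgue_on {0..})" for n
    using L2_inner_integrable[OF trunc_L2[OF u] trunc_L2[OF y]] by (rule borel_measurable_integrable)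
  show "AE t in lebesgue_on {0..}.
      (\<lambda>n. trunc (real n) u t \<bullet> trunc (real n) y t) \<longlonglongrightarrow> u t \<bullet> y t"
  proof (rule AE_I2)
    fix t :: real
    have "\<forall>\<^sub>F n in sequentially. t \<le> real n"
      using filterlim_real_sequentially by (auto simp: filterlim_at_top)
    then have "\<forall>\<^sub>F n in sequentially. trunc (real n) u t \<bullet> trunc (real n) y t = u t \<bullet> y t"
      by eventually_elim (simp add: trunc_def)
    then show "(\<lambda>n. trunc (real n) u t \<bullet> trunc (real n) y t) \<longlonglongrightarrow> u t \<bullet> y t"
      by (rule tendsto_eventually)
  qed
  show "AE t in lebesgue_on {0..}. norm (trunc (real n) u t \<bullet> trunc (real n) y t) \<le> \<bar>u t \<bullet> y t\<bar>" for n
    by (simp add: trunc_def)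
qed

theorem theorem1:
  fixes H :: "'n::finite signal \<Rightarrow> 'n signal" and a b c :: real
  assumes "L2e_map H" and "causal H" and "L2_stable H"
    and "positive_negative (multiplier a b c)"
  shows "soft_SG H \<subseteq> multiplier_region (multiplier a b c) \<longleftrightarrow>
         hard_SG H \<subseteq> multiplier_region (multiplier a b c)"
proof -
  \<comment> \<open>Both inclusions turn into sign conditions on this form.\<close>
  define q where "q u y = a * sig_inner y y + 2 * b * sig_inner u y + c * sig_inner u u"
    for u y :: "'n signal"
  have a: "a < 0" using assms(4) by (simp add: positive_negative_multiplier_iff)
  have HL2: "H u \<in> L2" if "u \<in> L2" for u using assms(3) that by (auto simp: L2_stable_def)
  have truncL2: "trunc T u \<in> L2" if "u \<in> L2e" "T > 0" for u :: "'n signal" and T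
    using that by (simp add: L2e_def)
  have HL2e: "H u \<in> L2e" if "u \<in> L2e" for u using assms(1) that by (auto simp: L2e_map_def)
  have soft: "soft_SG H \<subseteq> multiplier_region (multiplier a b c) \<longleftrightarrow>
      (\<forall>u\<in>L2. \<not> sig_eq u (\<lambda>_. 0) \<longrightarrow> 0 \<le> q u (H u))"
    unfolding soft_SG_def UN_subset_iff q_def using sg_points_region_iff HL2 by blast
  have "sg_points (trunc T u) (trunc T (H u)) \<subseteq> multiplier_region (multiplier a b c) \<longleftrightarrow>
      0 \<le> q (trunc T u) (trunc T (H u))"
    if "u \<in> L2e" "T > 0" "\<not> sig_eq (trunc T u) (\<lambda>_. 0)" for u T
    unfolding q_def using that truncL2 HL2e by (intro sg_points_region_iff) auto
  then have hard: "hard_SG H \<subseteq> multiplier_region (multiplier a b c) \<longleftrightarrow>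
      (\<forall>u\<in>L2e. \<forall>T>0. \<not> sig_eq (trunc T u) (\<lambda>_. 0) \<longrightarrow> 0 \<le> q (trunc T u) (trunc T (H u)))"
    unfolding hard_SG_def UN_subset_iff by auto
  show ?thesis
    unfolding soft hard
  proof (intro iffI ballI allI impI)
    fix u :: "'n signal" and T
    assume S: "\<forall>u\<in>L2. \<not> sig_eq u (\<lambda>_. 0) \<longrightarrow> 0 \<le> q u (H u)"
      and u: "u \<in> L2e" and T: "T > 0" and nz: "\<not> sig_eq (trunc T u) (\<lambda>_. 0)"
    \<comment> \<open>The input \<open>u\<close> may have infinite energy, so the soft condition is
      applied to its truncation, a nonzero element of \<open>L2\<close>.\<close>
    define v where "v = trunc T u"
    have v: "v \<in> L2" using truncL2[OF u T] by (simp add: v_def)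
    have w: "H v \<in> L2" by (rule HL2[OF v])
    have y: "trunc T (H u) \<in> L2" by (rule truncL2[OF HL2e[OF u] T])
    have "sig_eq (trunc T (H u)) (trunc T (H v))"
      using assms(2) u T by (simp add: causal_def v_def)
    moreover have "sig_eq v v" by (simp add: sig_eq_def)
    ultimately have "sig_inner v (trunc T (H u)) = sig_inner v (trunc T (H v))"
      "sig_inner (trunc T (H u)) (trunc T (H u)) = sig_inner (trunc T (H v)) (trunc T (H v))"
      using v y trunc_L2[OF w, of T] by (simp_all add: sig_inner_cong)
    then have "q v (trunc T (H u)) = q v (trunc T (H v))" by (simp add: q_def)
    \<comment> \<open>As \<open>v\<close> is itself a truncation at \<open>T\<close>, the cross term
      does not notice the truncation of \<open>H v\<close>.\<close>
    also have "\<dots> = a * sig_inner (trunc T (H v)) (trunc T (H v)) + 2 * b * sig_inner v (H v)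
        + c * sig_inner v v"
      using sig_inner_trunc_right[of T u "H v"] by (simp add: q_def v_def)
    \<comment> \<open>Only the output energy differs; dropping the truncation increases it, and the
      factor \<open>a < 0\<close> reverses the inequality.\<close>
    also have "\<dots> \<ge> q v (H v)"
      using mult_left_mono_neg[OF sig_inner_trunc_le[OF w], of a T] a by (simp add: q_def)
    finally have "q v (H v) \<le> q v (trunc T (H u))" .
    moreover have "0 \<le> q v (H v)" using S v nz by (simp add: v_def)
    ultimately show "0 \<le> q (trunc T u) (trunc T (H u))" by (simp add: v_def)
  next
    fix u :: "'n signal"
    assume h: "\<forall>u\<in>L2e. \<forall>T>0. \<not> sig_eq (trunc T u) (\<lambda>_. 0) \<longrightarrow>
        0 \<le> q (trunc T u) (trunc T (H u))"
      and u: "u \<in> L2" and nz: "\<not> sig_eq u (\<lambda>_. 0)"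
    have y: "H u \<in> L2" by (rule HL2[OF u])
    \<comment> \<open>The hard condition speaks only of nonzero truncations. Their energies tend to
      that of \<open>u\<close>, so a positive limit makes them nonzero eventually.\<close>
    have "0 < sig_inner u u"
      using sig_inner_self_eq_0_iff[OF u] nz sig_inner_self_nonneg[of u] by linarith
    then have "\<forall>\<^sub>F n in sequentially. 0 < sig_inner (trunc (real n) u) (trunc (real n) u)"
      by (rule order_tendstoD(1)[OF sig_inner_trunc_tendsto[OF u u]])
    then have "\<forall>\<^sub>F n in sequentially. 0 \<le> q (trunc (real n) u) (trunc (real n) (H u))"
      \<comment> \<open>The index 0 is excluded because the hard graph requires
        \<open>T > 0\<close>.\<close>
      using eventually_gt_at_top[of 0]
    proof eventually_elim
      case (elim n)
      then have "\<not> sig_eq (trunc (real n) u) (\<lambda>_. 0)"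
        using sig_inner_self_eq_0_iff[OF trunc_L2[OF u], of "real n"] by simp
      with h u L2_subset_L2e elim(2) show ?case by auto
    qed
    \<comment> \<open>All three inner products converge, and the non-strict inequality survives the
      limit.\<close>
    moreover have "(\<lambda>n. q (trunc (real n) u) (trunc (real n) (H u))) \<longlonglongrightarrow> q u (H u)"
      unfolding q_def by (intro tendsto_intros sig_inner_trunc_tendsto u y)
    ultimately show "0 \<le> q u (H u)"
      by (intro tendsto_lowerbound) auto
  qed
qed

end
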